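(* Let $\mathcal{C}$ be a pointed regular category and let $i\colon I\to Y$ be a morphism of $\mathcal{C}$. The following conditions are equivalent: (i) $i$ is an ideal; (ii) $i$ is the zero-class of a surjective left split relation (from some object $X$ of $\mathcal{C}$ to $Y$); (iii) $i$ is the zero-class of a surjective relation (from some object $X$ of $\mathcal{C}$ to $Y$).
   Context: A category is pointed if it has a zero object; $0$ also denotes zero morphisms. A regular category is a finitely complete category with pullback-stable (regular epimorphism, monomorphism) factorisations. A span from $X$ to $Y$ is a pair of morphisms $(d\colon R\to X,\ c\colon R\to Y)$. It is a relation if $d,c$ are jointly monomorphic, i.e. $\langle d,c\rangle\colon R\to X\times Y$ is a monomorphism. A relation on $X$ is a relation from $X$ to $X$; it is reflexive if there is $e\colon X\to R$ with $de=1_X=ce$. A zero-class of a span $(d,c)$ from $X$ to $Y$ is the morphism $i\colon I\to Y$ obtained as the pullback of $\langle d,c\rangle\colon R\to X\times Y$ along $\langle 0,1_Y\rangle\colon Y\to X\times Y$; it is unique up to isomorphism over $Y$. A left split span from $X$ to $Y$ is a triple $(d\colon R\to X,\ c\colon R\to Y,\ e\colon X\to R)$ with $de=1_X$; its zero-class is that of $(d,c)$. It is a left split relation if $(d,c)$ is jointly monomorphic. A span $(d,c)$ from $X$ to $Y$ is surjective if $c$ is a regular epimorphism; a surjective relation is a surjective span which is a relation. A surjective left split relation is a left split relation $(d,c,e)$ in which $c$ is a regular epimorphism. A clot of an object $A$ is a morphism to $A$ that is the zero-class of a reflexive relation on $A$ (it is necessarily a monomorphism). A monomorphism $i\colon I\to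 Y$ is an ideal if there exist a clot $k\colon K\to X$ and regular epimorphisms $p\colon X\to Y$ and $q\colon K\to I$ such that $iq=pk$. A morphism is called an ideal when it is such a monomorphism. *)

theory Defs
  imports Main
begin

section \<open>Categories\<close>

text \<open>
  A category carries its objects and arrows as explicit sets. The composite
  \<open>g \<cdot>\<^bsub>C\<^esub> f\<close> is written in the usual order (first \<open>f\<close>, then \<open>g\<close>) and is only meaningful
  when \<open>Cod C f = Dom C g\<close>.
\<close>

record ('o, 'm) category_data =
  Ob :: "'o set"
  Arr :: "'m set"
  Dom :: "'m \<Rightarrow> 'o"
  Cod :: "'m \<Rightarrow> 'o"
  Ident :: "'o \<Rightarrow> 'm"
  Comp :: "'m \<Rightarrow> 'm \<Rightarrow> 'm"  (infixr "\<cdot>\<index>" 70)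

definition hom :: "('o, 'm) category_data \<Rightarrow> 'o \<Rightarrow> 'o \<Rightarrow> 'm set" where
  "hom C X Y = {f \<in> Arr C. Dom C f = X \<and> Cod C f = Y}"

locale category =
  fixes C :: "('o, 'm) category_data" (structure)
  assumes dom_Ob: "f \<in> Arr C \<Longrightarrow> Dom C f \<in> Ob C"
    and cod_Ob: "f \<in> Arr C \<Longrightarrow> Cod C f \<in> Ob C"
    and ident_hom: "X \<in> Ob C \<Longrightarrow> Ident C X \<in> hom C X X"
    and comp_hom: "\<lbrakk>f \<in> hom C X Y; g \<in> hom C Y Z\<rbrakk> \<Longrightarrow> g \<cdot> f \<in> hom C X Z"
    and comp_ident_right: "f \<in> hom C X Y \<Longrightarrow> f \<cdot> Ident C X = f"
    and comp_ident_left: "f \<in> hom C X Y \<Longrightarrow> Ident C Y \<cdot> f = f"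
    and comp_assoc: "\<lbrakk>f \<in> hom C W X; g \<in> hom C X Y; h \<in> hom C Y Z\<rbrakk>
      \<Longrightarrow> (h \<cdot> g) \<cdot> f = h \<cdot> (g \<cdot> f)"


section \<open>Finite limits\<close>

definition is_functor ::
  "('j, 'a) category_data \<Rightarrow> ('o, 'm) category_data \<Rightarrow> ('j \<Rightarrow> 'o) \<Rightarrow> ('a \<Rightarrow> 'm) \<Rightarrow> bool" where
  "is_functor J C Fo Fa \<longleftrightarrow>
     (\<forall>j \<in> Ob J. Fo j \<in> Ob C) \<and>
     (\<forall>a \<in> Arr J. Fa a \<in> hom C (Fo (Dom J a)) (Fo (Cod J a))) \<and>
     (\<forall>j \<in> Ob J. Fa (Ident J j) = Ident C (Fo j)) \<and>
     (\<forall>a \<in> Arr J. \<forall>b \<in> Arr J. Cod J a = Dom J b \<longrightarrow>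
        Fa (b \<cdot>\<^bsub>J\<^esub> a) = Fa b \<cdot>\<^bsub>C\<^esub> Fa a)"

definition is_cone ::
  "('j, 'a) category_data \<Rightarrow> ('o, 'm) category_data \<Rightarrow> ('j \<Rightarrow> 'o) \<Rightarrow> ('a \<Rightarrow> 'm)
     \<Rightarrow> 'o \<Rightarrow> ('j \<Rightarrow> 'm) \<Rightarrow> bool" where
  "is_cone J C Fo Fa L \<pi> \<longleftrightarrow>
     L \<in> Ob C \<and>
     (\<forall>j \<in> Ob J. \<pi> j \<in> hom C L (Fo j)) \<and>
     (\<forall>a \<in> Arr J. Fa a \<cdot>\<^bsub>C\<^esub> \<pi> (Dom J a) = \<pi> (Cod J a))"

definition is_limit ::
  "('j, 'a) category_data \<Rightarrow> ('o, 'm) category_data \<Rightarrow> ('j \<Rightarrow> 'o) \<Rightarrow> ('a \<Rightarrow> 'm)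
     \<Rightarrow> 'o \<Rightarrow> ('j \<Rightarrow> 'm) \<Rightarrow> bool" where
  "is_limit J C Fo Fa L \<pi> \<longleftrightarrow>
     is_cone J C Fo Fa L \<pi> \<and>
     (\<forall>T \<sigma>. is_cone J C Fo Fa T \<sigma> \<longrightarrow>
        (\<exists>!u. u \<in> hom C T L \<and> (\<forall>j \<in> Ob J. \<pi> j \<cdot>\<^bsub>C\<^esub> u = \<sigma> j)))"

text \<open>
  Every finite category is isomorphic to one whose objects and arrows are natural numbers,
  so index categories over \<open>nat\<close> account for all finite diagrams.
\<close>

definition finitely_complete :: "('o, 'm) category_data \<Rightarrow> bool" where
  "finitely_complete C \<longleftrightarrow>
     (\<forall>(J :: (nat, nat) category_data) Fo Fa.
        category J \<and> finite (Ob J) \<and> finite (Arr J) \<and> is_functor J C Fo Fa \<longrightarrow>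
        (\<exists>L \<pi>. is_limit J C Fo Fa L \<pi>))"

text \<open>\<open>is_product C X Y p\<^sub>1 p\<^sub>2\<close>: the span \<open>X \<leftarrow> P \<rightarrow> Y\<close> given by \<open>(p\<^sub>1, p\<^sub>2)\<close>, with
  \<open>P = Dom C p\<^sub>1\<close>, is a product of \<open>X\<close> and \<open>Y\<close>.\<close>

definition is_product ::
  "('o, 'm) category_data \<Rightarrow> 'o \<Rightarrow> 'o \<Rightarrow> 'm \<Rightarrow> 'm \<Rightarrow> bool" where
  "is_product C X Y p\<^sub>1 p\<^sub>2 \<longleftrightarrow>
     p\<^sub>1 \<in> hom C (Dom C p\<^sub>1) X \<and> p\<^sub>2 \<in> hom C (Dom C p\<^sub>1) Y \<and>
     (\<forall>T \<in> Ob C. \<forall>f \<in> hom C T X. \<forall>g \<in> hom C T Y.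
        \<exists>!h. h \<in> hom C T (Dom C p\<^sub>1) \<and> p\<^sub>1 \<cdot>\<^bsub>C\<^esub> h = f \<and> p\<^sub>2 \<cdot>\<^bsub>C\<^esub> h = g)"

text \<open>\<open>is_pairing C p\<^sub>1 p\<^sub>2 f g h\<close>: \<open>h\<close> is the morphism \<open>\<langle>f, g\<rangle>\<close> into the product with
  projections \<open>p\<^sub>1\<close>, \<open>p\<^sub>2\<close>.\<close>

definition is_pairing ::
  "('o, 'm) category_data \<Rightarrow> 'm \<Rightarrow> 'm \<Rightarrow> 'm \<Rightarrow> 'm \<Rightarrow> 'm \<Rightarrow> bool" where
  "is_pairing C p\<^sub>1 p\<^sub>2 f g h \<longleftrightarrow>
     h \<in> hom C (Dom C f) (Dom C p\<^sub>1) \<and> p\<^sub>1 \<cdot>\<^bsub>C\<^esub> h = f \<and> p\<^sub>2 \<cdot>\<^bsub>C\<^esub> h = g"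

text \<open>\<open>is_pullback C f g f' g'\<close>: \<open>f'\<close> is a pullback of \<open>f\<close> along \<open>g\<close>, with \<open>g'\<close> the other
  projection; the pullback square is \<open>f \<cdot> g' = g \<cdot> f'\<close>.\<close>

definition is_pullback ::
  "('o, 'm) category_data \<Rightarrow> 'm \<Rightarrow> 'm \<Rightarrow> 'm \<Rightarrow> 'm \<Rightarrow> bool" where
  "is_pullback C f g f' g' \<longleftrightarrow>
     f \<in> Arr C \<and> g \<in> Arr C \<and> Cod C f = Cod C g \<and>
     f' \<in> hom C (Dom C f') (Dom C g) \<and> g' \<in> hom C (Dom C f') (Dom C f) \<and>
     f \<cdot>\<^bsub>C\<^esub> g' = g \<cdot>\<^bsub>C\<^esub> f' \<and>
     (\<forall>T \<in> Ob C. \<forall>a \<in> hom C T (Dom C g). \<forall>b \<in> hom C T (Dom C f).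
        f \<cdot>\<^bsub>C\<^esub> b = g \<cdot>\<^bsub>C\<^esub> a \<longrightarrow>
        (\<exists>!u. u \<in> hom C T (Dom C f') \<and> f' \<cdot>\<^bsub>C\<^esub> u = a \<and> g' \<cdot>\<^bsub>C\<^esub> u = b))"


section \<open>Pointed and regular categories\<close>

definition is_zero_object :: "('o, 'm) category_data \<Rightarrow> 'o \<Rightarrow> bool" where
  "is_zero_object C Z \<longleftrightarrow>
     Z \<in> Ob C \<and>
     (\<forall>X \<in> Ob C. \<exists>!f. f \<in> hom C X Z) \<and>
     (\<forall>X \<in> Ob C. \<exists>!f. f \<in> hom C Z X)"

definition pointed :: "('o, 'm) category_data \<Rightarrow> bool" where
  "pointed C \<longleftrightarrow> (\<exists>Z. is_zero_object C Z)"

definition is_zero_morphism :: "('o, 'm) category_data \<Rightarrow> 'm \<Rightarrow> bool" where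
  "is_zero_morphism C f \<longleftrightarrow>
     (\<exists>Z a b. is_zero_object C Z \<and> a \<in> hom C (Dom C f) Z \<and> b \<in> hom C Z (Cod C f) \<and>
        f \<in> Arr C \<and> f = b \<cdot>\<^bsub>C\<^esub> a)"

definition is_mono :: "('o, 'm) category_data \<Rightarrow> 'm \<Rightarrow> bool" where
  "is_mono C m \<longleftrightarrow>
     m \<in> Arr C \<and>
     (\<forall>T \<in> Ob C. \<forall>u \<in> hom C T (Dom C m). \<forall>v \<in> hom C T (Dom C m).
        m \<cdot>\<^bsub>C\<^esub> u = m \<cdot>\<^bsub>C\<^esub> v \<longrightarrow> u = v)"

definition is_coequalizer :: "('o, 'm) category_data \<Rightarrow> 'm \<Rightarrow> 'm \<Rightarrow> 'm \<Rightarrow> bool" where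
  "is_coequalizer C f g q \<longleftrightarrow>
     f \<in> Arr C \<and> g \<in> hom C (Dom C f) (Cod C f) \<and>
     q \<in> hom C (Cod C f) (Cod C q) \<and>
     q \<cdot>\<^bsub>C\<^esub> f = q \<cdot>\<^bsub>C\<^esub> g \<and>
     (\<forall>T \<in> Ob C. \<forall>h \<in> hom C (Cod C f) T. h \<cdot>\<^bsub>C\<^esub> f = h \<cdot>\<^bsub>C\<^esub> g \<longrightarrow>
        (\<exists>!u. u \<in> hom C (Cod C q) T \<and> u \<cdot>\<^bsub>C\<^esub> q = h))"

definition is_regular_epi :: "('o, 'm) category_data \<Rightarrow> 'm \<Rightarrow> bool" where
  "is_regular_epi C q \<longleftrightarrow> (\<exists>f g. is_coequalizer C f g q)"

definition regepi_mono_factorisation ::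
  "('o, 'm) category_data \<Rightarrow> 'm \<Rightarrow> 'm \<Rightarrow> 'm \<Rightarrow> bool" where
  "regepi_mono_factorisation C f q m \<longleftrightarrow>
     is_regular_epi C q \<and> is_mono C m \<and> Cod C q = Dom C m \<and> f = m \<cdot>\<^bsub>C\<^esub> q"

text \<open>
  Stability: pulling a factorisation \<open>f = m \<cdot> q\<close> back along \<open>g\<close>, that is, first \<open>m\<close> along \<open>g\<close>
  and then \<open>q\<close> along the resulting projection \<open>g'\<close>, gives a factorisation \<open>m' \<cdot> q'\<close>
  (of a pullback of \<open>f\<close> along \<open>g\<close>) of the same kind.
\<close>

definition regular :: "('o, 'm) category_data \<Rightarrow> bool" where
  "regular C \<longleftrightarrow>
     finitely_complete C \<and>
     (\<forall>f \<in> Arr C. \<exists>q m. regepi_mono_factorisation C f q m) \<and>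
     (\<forall>f q m g m' g' q' g''.
        regepi_mono_factorisation C f q m \<and>
        is_pullback C m g m' g' \<and> is_pullback C q g' q' g'' \<longrightarrow>
        regepi_mono_factorisation C (m' \<cdot>\<^bsub>C\<^esub> q') q' m')"


section \<open>Spans, relations and zero-classes\<close>

text \<open>The apex \<open>R\<close> of a span \<open>(d, c)\<close> is \<open>Dom C d\<close>.\<close>

definition is_span :: "('o, 'm) category_data \<Rightarrow> 'o \<Rightarrow> 'o \<Rightarrow> 'm \<Rightarrow> 'm \<Rightarrow> bool" where
  "is_span C X Y d c \<longleftrightarrow> d \<in> hom C (Dom C d) X \<and> c \<in> hom C (Dom C d) Y"

definition jointly_mono :: "('o, 'm) category_data \<Rightarrow> 'm \<Rightarrow> 'm \<Rightarrow> bool" where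
  "jointly_mono C d c \<longleftrightarrow>
     (\<forall>T \<in> Ob C. \<forall>u \<in> hom C T (Dom C d). \<forall>v \<in> hom C T (Dom C d).
        d \<cdot>\<^bsub>C\<^esub> u = d \<cdot>\<^bsub>C\<^esub> v \<and> c \<cdot>\<^bsub>C\<^esub> u = c \<cdot>\<^bsub>C\<^esub> v \<longrightarrow> u = v)"

definition is_relation :: "('o, 'm) category_data \<Rightarrow> 'o \<Rightarrow> 'o \<Rightarrow> 'm \<Rightarrow> 'm \<Rightarrow> bool" where
  "is_relation C X Y d c \<longleftrightarrow> is_span C X Y d c \<and> jointly_mono C d c"

definition is_reflexive_relation :: "('o, 'm) category_data \<Rightarrow> 'o \<Rightarrow> 'm \<Rightarrow> 'm \<Rightarrow> bool" where
  "is_reflexive_relation C X d c \<longleftrightarrow>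
     is_relation C X X d c \<and>
     (\<exists>e \<in> hom C X (Dom C d). d \<cdot>\<^bsub>C\<^esub> e = Ident C X \<and> c \<cdot>\<^bsub>C\<^esub> e = Ident C X)"

text \<open>
  \<open>i\<close> is a zero-class of the span \<open>(d, c)\<close> from \<open>X\<close> to \<open>Y\<close>: a pullback of \<open>\<langle>d, c\<rangle>\<close> along
  \<open>\<langle>0, 1\<^sub>Y\<rangle>\<close>. Zero-classes are determined up to isomorphism only, hence a predicate; the
  choice of the product \<open>X \<times> Y\<close> is immaterial.
\<close>

definition is_zero_class ::
  "('o, 'm) category_data \<Rightarrow> 'o \<Rightarrow> 'o \<Rightarrow> 'm \<Rightarrow> 'm \<Rightarrow> 'm \<Rightarrow> bool" where
  "is_zero_class C X Y d c i \<longleftrightarrow>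
     is_span C X Y d c \<and>
     (\<exists>p\<^sub>1 p\<^sub>2 z dc z1 j.
        is_product C X Y p\<^sub>1 p\<^sub>2 \<and>
        is_pairing C p\<^sub>1 p\<^sub>2 d c dc \<and>
        z \<in> hom C Y X \<and> is_zero_morphism C z \<and>
        is_pairing C p\<^sub>1 p\<^sub>2 z (Ident C Y) z1 \<and>
        is_pullback C dc z1 i j)"

definition is_left_split_span ::
  "('o, 'm) category_data \<Rightarrow> 'o \<Rightarrow> 'o \<Rightarrow> 'm \<Rightarrow> 'm \<Rightarrow> 'm \<Rightarrow> bool" where
  "is_left_split_span C X Y d c e \<longleftrightarrow>
     is_span C X Y d c \<and> e \<in> hom C X (Dom C d) \<and> d \<cdot>\<^bsub>C\<^esub> e = Ident C X"

definition is_left_split_relation ::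
  "('o, 'm) category_data \<Rightarrow> 'o \<Rightarrow> 'o \<Rightarrow> 'm \<Rightarrow> 'm \<Rightarrow> 'm \<Rightarrow> bool" where
  "is_left_split_relation C X Y d c e \<longleftrightarrow>
     is_left_split_span C X Y d c e \<and> jointly_mono C d c"

definition is_surjective_left_split_relation ::
  "('o, 'm) category_data \<Rightarrow> 'o \<Rightarrow> 'o \<Rightarrow> 'm \<Rightarrow> 'm \<Rightarrow> 'm \<Rightarrow> bool" where
  "is_surjective_left_split_relation C X Y d c e \<longleftrightarrow>
     is_left_split_relation C X Y d c e \<and> is_regular_epi C c"

definition is_surjective_span ::
  "('o, 'm) category_data \<Rightarrow> 'o \<Rightarrow> 'o \<Rightarrow> 'm \<Rightarrow> 'm \<Rightarrow> bool" where
  "is_surjective_span C X Y d c \<longleftrightarrow> is_span C X Y d c \<and> is_regular_epi C c"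

definition is_surjective_relation ::
  "('o, 'm) category_data \<Rightarrow> 'o \<Rightarrow> 'o \<Rightarrow> 'm \<Rightarrow> 'm \<Rightarrow> bool" where
  "is_surjective_relation C X Y d c \<longleftrightarrow> is_surjective_span C X Y d c \<and> is_relation C X Y d c"


section \<open>Clots and ideals\<close>

definition is_clot :: "('o, 'm) category_data \<Rightarrow> 'o \<Rightarrow> 'm \<Rightarrow> bool" where
  "is_clot C A k \<longleftrightarrow>
     (\<exists>d c. is_reflexive_relation C A d c \<and> is_zero_class C A A d c k)"

definition is_ideal :: "('o, 'm) category_data \<Rightarrow> 'm \<Rightarrow> bool" where
  "is_ideal C i \<longleftrightarrow>
     is_mono C i \<and>
     (\<exists>K X k p q.
        k \<in> hom C K X \<and> is_clot C X k \<and>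
        p \<in> hom C X (Cod C i) \<and> is_regular_epi C p \<and>
        q \<in> hom C K (Dom C i) \<and> is_regular_epi C q \<and>
        i \<cdot>\<^bsub>C\<^esub> q = p \<cdot>\<^bsub>C\<^esub> k)"

end

theory Submission
  imports Defs
begin

text \<open>
  The zero-class of a span \<open>(d, c)\<close> is \<open>c \<cdot> \<kappa>\<close>, where \<open>\<kappa>\<close> is a kernel of \<open>d\<close>: a generalised
  element of the pullback of \<open>\<langle>d, c\<rangle>\<close> along \<open>\<langle>0, 1\<rangle>\<close> is a pair \<open>(r, y)\<close> with \<open>d r = 0\<close> and
  \<open>c r = y\<close>. This is \<open>zero_class_iff_kernel\<close>, and it turns the theorem into a statement about
  kernels.

  A surjective left split relation is a surjective relation, so two implications remain.

  Let \<open>(d, c)\<close> be a surjective relation from \<open>X\<close> to \<open>Y\<close> with apex \<open>R\<close>, and \<open>\<kappa>\<close> a kernel of \<open>d\<close>.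
  Kernels are clots (\<open>kernel_is_clot\<close>): \<open>\<kappa>\<close> is the zero-class of the kernel pair of \<open>d\<close>. So the
  zero-class \<open>c \<cdot> \<kappa>\<close> is the image of the clot \<open>\<kappa>\<close> of \<open>R\<close> under the regular epimorphism
  \<open>c\<close>, and it is a monomorphism because \<open>d\<close> and \<open>c\<close> are jointly monomorphic; hence it is an ideal
  (\<open>surjective_relation_zero_class_is_ideal\<close>).

  Conversely, let \<open>i \<cdot> q = p \<cdot> k\<close> exhibit \<open>i\<close> as an ideal, where \<open>k = c \<cdot> \<kappa>\<close> is the zero-class of a
  reflexive relation \<open>(d, c)\<close> on \<open>X\<close> with section \<open>e\<close> and \<open>\<kappa>\<close> is a kernel of \<open>d\<close>. The image
  \<open>(d', c')\<close> of the span \<open>(d, p \<cdot> c)\<close> along a regular epimorphism \<open>s\<close> is a relation from \<open>X\<close> to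
  \<open>Y\<close>, it is split on the left by \<open>s \<cdot> e\<close>, and \<open>c'\<close> is a regular epimorphism because
  \<open>c' \<cdot> s \<cdot> e = p\<close> is one. The comparison \<open>\<sigma>\<close> from the kernel of \<open>d\<close> to a kernel \<open>\<kappa>'\<close> of \<open>d'\<close> is a
  pullback of \<open>s\<close>, hence a regular epimorphism. So \<open>p \<cdot> k\<close> factors both as \<open>i \<cdot> q\<close> and as
  \<open>(c' \<cdot> \<kappa>') \<cdot> \<sigma>\<close>, each time a regular epimorphism followed by a monomorphism; by uniqueness of
  such factorisations \<open>i\<close> is, up to isomorphism, the zero-class \<open>c' \<cdot> \<kappa>'\<close> of \<open>(d', c')\<close>
  (\<open>ideal_is_zero_class\<close>).
\<close>

section \<open>Monomorphisms and regular epimorphisms\<close>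

lemma homD: "f \<in> hom C X Y \<Longrightarrow> f \<in> Arr C \<and> Dom C f = X \<and> Cod C f = Y"
  by (simp add: hom_def)

lemma monoD:
  assumes "is_mono C m" "m \<in> hom C X Y" "T \<in> Ob C" "u \<in> hom C T X" "v \<in> hom C T X"
    and "m \<cdot>\<^bsub>C\<^esub> u = m \<cdot>\<^bsub>C\<^esub> v"
  shows "u = v"
  using assms unfolding is_mono_def hom_def by blast

context category
begin

lemma hom_Ob: "f \<in> hom C X Y \<Longrightarrow> X \<in> Ob C \<and> Y \<in> Ob C"
  using dom_Ob cod_Ob by (auto simp: hom_def)

lemma Arr_hom: "f \<in> Arr C \<Longrightarrow> f \<in> hom C (Dom C f) (Cod C f)"
  by (simp add: hom_def)

lemma mono_comp_factor:
  assumes m: "is_mono C (g \<cdot> f)" and f: "f \<in> hom C X Y" and g: "g \<in> hom C Y Z"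
  shows "is_mono C f"
  unfolding is_mono_def
proof (intro conjI ballI impI)
  show "f \<in> Arr C" using f homD by fast
  fix T u v
  assume T: "T \<in> Ob C" and "u \<in> hom C T (Dom C f)" "v \<in> hom C T (Dom C f)"
    and eq: "f \<cdot> u = f \<cdot> v"
  then have u: "u \<in> hom C T X" and v: "v \<in> hom C T X" using f homD by fastforce+
  have "(g \<cdot> f) \<cdot> u = (g \<cdot> f) \<cdot> v"
    using comp_assoc[OF u f g] comp_assoc[OF v f g] eq by simp
  then show "u = v" using monoD[OF m comp_hom[OF f g] T u v] by simp
qed

lemma regular_epi_Arr: "is_regular_epi C q \<Longrightarrow> q \<in> Arr C"
  unfolding is_regular_epi_def is_coequalizer_def by (auto dest: homD)

lemma regular_epi_is_epi:
  assumes q: "is_regular_epi C q" "q \<in> hom C A B" and u: "u \<in> hom C B T" and v: "v \<in> hom C B T"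
    and eq: "u \<cdot> q = v \<cdot> q"
  shows "u = v"
proof -
  obtain a b where ab: "is_coequalizer C a b q" using q is_regular_epi_def by metis
  then have a: "a \<in> hom C (Dom C a) A" and b: "b \<in> hom C (Dom C a) A" and
    qab: "q \<cdot> a = q \<cdot> b"
    using q unfolding is_coequalizer_def hom_def by auto
  have "(u \<cdot> q) \<cdot> a = (u \<cdot> q) \<cdot> b"
    using comp_assoc[OF a q(2) u] comp_assoc[OF b q(2) u] qab by simp
  moreover have "u \<cdot> q \<in> hom C (Cod C a) T" "T \<in> Ob C" "Cod C q = B"
    using comp_hom[OF q(2) u] a hom_Ob[OF u] q(2) by (auto simp: hom_def)
  ultimately have "\<exists>!w. w \<in> hom C B T \<and> w \<cdot> q = u \<cdot> q"
    using ab unfolding is_coequalizer_def by blast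
  then show ?thesis using u v eq by metis
qed

text \<open>Regular epimorphisms are strong: if \<open>q\<close> coequalises \<open>a\<close> and \<open>b\<close>, then \<open>m \<cdot> u = v \<cdot> q\<close> forces
  \<open>u \<cdot> a = u \<cdot> b\<close>, because \<open>m\<close> can be cancelled.\<close>

lemma regular_epi_mono_diagonal:
  assumes q: "is_regular_epi C q" "q \<in> hom C A B"
    and m: "is_mono C m" "m \<in> hom C M D"
    and u: "u \<in> hom C A M" and v: "v \<in> hom C B D" and eq: "m \<cdot> u = v \<cdot> q"
  obtains w where "w \<in> hom C B M" "w \<cdot> q = u" "m \<cdot> w = v"
proof -
  obtain a b where ab: "is_coequalizer C a b q" using q is_regular_epi_def by metis
  then have a: "a \<in> hom C (Dom C a) A" and b: "b \<in> hom C (Dom C a) A" and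
    qab: "q \<cdot> a = q \<cdot> b"
    using q unfolding is_coequalizer_def hom_def by auto
  have "m \<cdot> (u \<cdot> a) = v \<cdot> (q \<cdot> a)"
    using comp_assoc[OF a u m(2)] comp_assoc[OF a q(2) v] eq by simp
  moreover have "m \<cdot> (u \<cdot> b) = v \<cdot> (q \<cdot> b)"
    using comp_assoc[OF b u m(2)] comp_assoc[OF b q(2) v] eq by simp
  ultimately have "u \<cdot> a = u \<cdot> b"
    using monoD[OF m _ comp_hom[OF a u] comp_hom[OF b u]] qab hom_Ob[OF a] by simp
  moreover have "u \<in> hom C (Cod C a) M" "M \<in> Ob C" "Cod C q = B"
    using u a hom_Ob[OF u] q(2) by (auto simp: hom_def)
  ultimately obtain w where w: "w \<in> hom C B M" "w \<cdot> q = u"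
    using ab unfolding is_coequalizer_def by metis
  have "(m \<cdot> w) \<cdot> q = v \<cdot> q"
    using comp_assoc[OF q(2) w(1) m(2)] w eq by simp
  then have "m \<cdot> w = v"
    using regular_epi_is_epi[OF q comp_hom[OF w(1) m(2)] v] by simp
  with w that show thesis by blast
qed

lemma ident_regular_epi:
  assumes "X \<in> Ob C" shows "is_regular_epi C (Ident C X)"
proof -
  note i = ident_hom[OF assms]
  have "is_coequalizer C (Ident C X) (Ident C X) (Ident C X)"
    using i homD[OF i] comp_ident_right comp_ident_left[OF i]
    unfolding is_coequalizer_def by (metis (no_types, lifting))
  then show ?thesis unfolding is_regular_epi_def by blast
qed

lemma ident_mono: "X \<in> Ob C \<Longrightarrow> is_mono C (Ident C X)"
  using ident_hom[of X] homD[OF ident_hom[of X]] comp_ident_left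
  unfolding is_mono_def by metis

lemma iso_comp_regular_epi:
  assumes q: "is_regular_epi C q" "q \<in> hom C A B"
    and m: "m \<in> hom C B D" and w: "w \<in> hom C D B"
    and mw: "m \<cdot> w = Ident C D" and wm: "w \<cdot> m = Ident C B"
  shows "is_regular_epi C (m \<cdot> q)"
proof -
  obtain a b where ab: "is_coequalizer C a b q" using q is_regular_epi_def by metis
  then have a: "a \<in> hom C (Dom C a) A" and b: "b \<in> hom C (Dom C a) A" and
    qab: "q \<cdot> a = q \<cdot> b"
    using q unfolding is_coequalizer_def hom_def by auto
  note mq = comp_hom[OF q(2) m]
  have "is_coequalizer C a b (m \<cdot> q)"
    unfolding is_coequalizer_def
  proof (intro conjI ballI impI)
    show "a \<in> Arr C" "b \<in> hom C (Dom C a) (Cod C a)" "m \<cdot> q \<in> hom C (Cod C a) (Cod C (m \<cdot> q))"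
      using a b mq by (auto simp: hom_def)
    show "(m \<cdot> q) \<cdot> a = (m \<cdot> q) \<cdot> b"
      using comp_assoc[OF a q(2) m] comp_assoc[OF b q(2) m] qab by simp
    fix T h
    assume T: "T \<in> Ob C" and h: "h \<in> hom C (Cod C a) T" and hab: "h \<cdot> a = h \<cdot> b"
    obtain u where u: "u \<in> hom C B T" "u \<cdot> q = h"
      using ab T h hab homD[OF q(2)] unfolding is_coequalizer_def by metis
    have D: "Cod C (m \<cdot> q) = D" using mq by (simp add: hom_def)
    have "(u \<cdot> w) \<cdot> (m \<cdot> q) = u \<cdot> ((w \<cdot> m) \<cdot> q)"
      using comp_assoc[OF mq w u(1)] comp_assoc[OF q(2) m w] by simp
    also have "\<dots> = h" using wm comp_ident_left[OF q(2)] u by simp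
    finally have ex: "(u \<cdot> w) \<cdot> (m \<cdot> q) = h" .
    show "\<exists>!u. u \<in> hom C (Cod C (m \<cdot> q)) T \<and> u \<cdot> (m \<cdot> q) = h"
    proof (rule ex1I[of _ "u \<cdot> w"])
      show "u \<cdot> w \<in> hom C (Cod C (m \<cdot> q)) T \<and> (u \<cdot> w) \<cdot> (m \<cdot> q) = h"
        using comp_hom[OF w u(1)] ex D by simp
      fix x assume "x \<in> hom C (Cod C (m \<cdot> q)) T \<and> x \<cdot> (m \<cdot> q) = h"
      then have x: "x \<in> hom C D T" "x \<cdot> (m \<cdot> q) = h" using D by auto
      have "(x \<cdot> m) \<cdot> q = u \<cdot> q" using comp_assoc[OF q(2) m x(1)] x u by simp
      then have "x \<cdot> m = u" using regular_epi_is_epi[OF q comp_hom[OF m x(1)] u(1)] by simp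
      then have "u \<cdot> w = x \<cdot> (m \<cdot> w)" using comp_assoc[OF w m x(1)] by simp
      then show "x = u \<cdot> w" using mw comp_ident_right[OF x(1)] by simp
    qed
  qed
  then show ?thesis unfolding is_regular_epi_def by blast
qed

section \<open>Pullbacks\<close>

lemma pullbackI:
  assumes f: "f \<in> hom C X Z" and g: "g \<in> hom C Y Z"
    and f': "f' \<in> hom C P Y" and g': "g' \<in> hom C P X" and eq: "f \<cdot> g' = g \<cdot> f'"
    and univ: "\<And>T a b. \<lbrakk>T \<in> Ob C; a \<in> hom C T Y; b \<in> hom C T X; f \<cdot> b = g \<cdot> a\<rbrakk>
      \<Longrightarrow> \<exists>!u. u \<in> hom C T P \<and> f' \<cdot> u = a \<and> g' \<cdot> u = b"
  shows "is_pullback C f g f' g'"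
  using assms homD[OF f] homD[OF g] homD[OF f'] unfolding is_pullback_def by simp

lemma pullbackD:
  assumes "is_pullback C f g f' g'" "f \<in> hom C X Z" "g \<in> hom C Y Z"
  shows "f' \<in> hom C (Dom C f') Y" "g' \<in> hom C (Dom C f') X" "f \<cdot> g' = g \<cdot> f'"
    "\<And>T a b. \<lbrakk>a \<in> hom C T Y; b \<in> hom C T X; f \<cdot> b = g \<cdot> a\<rbrakk>
      \<Longrightarrow> \<exists>!u. u \<in> hom C T (Dom C f') \<and> f' \<cdot> u = a \<and> g' \<cdot> u = b"
proof -
  show "f' \<in> hom C (Dom C f') Y" "g' \<in> hom C (Dom C f') X" "f \<cdot> g' = g \<cdot> f'"
    using assms homD[OF assms(2)] homD[OF assms(3)] unfolding is_pullback_def by auto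
  fix T a b assume ab: "a \<in> hom C T Y" "b \<in> hom C T X" "f \<cdot> b = g \<cdot> a"
  then show "\<exists>!u. u \<in> hom C T (Dom C f') \<and> f' \<cdot> u = a \<and> g' \<cdot> u = b"
    using assms(1) homD[OF assms(2)] homD[OF assms(3)] hom_Ob[OF ab(1)]
    unfolding is_pullback_def by auto
qed

lemma ident_pullback:
  assumes g: "g \<in> hom C X Y"
  shows "is_pullback C (Ident C Y) g (Ident C X) g"
proof (rule pullbackI)
  have X: "X \<in> Ob C" and Y: "Y \<in> Ob C" using hom_Ob[OF g] by auto
  show "Ident C Y \<in> hom C Y Y" "Ident C X \<in> hom C X X" "g \<in> hom C X Y" "g \<in> hom C X Y"
    using ident_hom X Y g by auto
  show "Ident C Y \<cdot> g = g \<cdot> Ident C X" using comp_ident_left[OF g] comp_ident_right[OF g] by simp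
  fix T a b assume a: "a \<in> hom C T X" and b: "b \<in> hom C T Y" and eq: "Ident C Y \<cdot> b = g \<cdot> a"
  have "g \<cdot> a = b" using eq comp_ident_left[OF b] by simp
  then show "\<exists>!u. u \<in> hom C T X \<and> Ident C X \<cdot> u = a \<and> g \<cdot> u = b"
    using a comp_ident_left by metis
qed

end

text \<open>The objects \<open>0\<close>, \<open>1\<close>, \<open>2\<close> also serve as their identities; the other arrows are
  \<open>3: 0 \<rightarrow> 2\<close> and \<open>4: 1 \<rightarrow> 2\<close>. A composite is the later arrow unless the earlier one is \<open>3\<close>
  or \<open>4\<close>, in which case the later one is the identity \<open>2\<close>.\<close>

definition cospan_shape :: "(nat, nat) category_data" where
  "cospan_shape = \<lparr>Ob = {0, 1, 2}, Arr = {0, 1, 2, 3, 4},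
     Dom = (\<lambda>a. if a = 3 then 0 else if a = 4 then 1 else a),
     Cod = (\<lambda>a. if a = 3 \<or> a = 4 then 2 else a),
     Ident = (\<lambda>a. a),
     Comp = (\<lambda>b a. if a = 3 \<or> a = 4 then a else b)\<rparr>"

lemma cospan_shape_category: "category cospan_shape"
  by unfold_locales (auto simp: cospan_shape_def hom_def split: if_splits)

locale pointed_regular_category = category C
  for C :: "('o, 'm) category_data" (structure) +
  assumes pointed: "pointed C"
    and regular: "regular C"
begin

lemma pullback_exists:
  assumes f: "f \<in> hom C X Z" and g: "g \<in> hom C Y Z"
  obtains f' g' where "is_pullback C f g f' g'"
proof -
  define Fo :: "nat \<Rightarrow> 'o" where "Fo j = (if j = 0 then X else if j = 1 then Y else Z)" for j
  define Fa :: "nat \<Rightarrow> 'm" where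
    "Fa a = (if a = 3 then f else if a = 4 then g else Ident C (Fo a))" for a
  let ?J = cospan_shape
  have Fo: "Fo 0 = X" "Fo (Suc 0) = Y" "Fo 2 = Z" unfolding Fo_def by simp_all
  have Ob: "X \<in> Ob C" "Y \<in> Ob C" "Z \<in> Ob C" using hom_Ob[OF f] hom_Ob[OF g] by auto
  have Fa: "Fa 0 = Ident C X" "Fa (Suc 0) = Ident C Y" "Fa 2 = Ident C Z" "Fa 3 = f" "Fa 4 = g"
    unfolding Fa_def by (simp_all add: Fo)
  note ident = Ob[THEN ident_hom]
  note unit = ident[THEN comp_ident_left] f[THEN comp_ident_left] g[THEN comp_ident_left]
    f[THEN comp_ident_right] g[THEN comp_ident_right]
  have "is_functor ?J C Fo Fa"
    unfolding is_functor_def cospan_shape_def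
    using Ob f g ident unit by (auto simp: Fo Fa)
  moreover have "finite (Ob ?J)" "finite (Arr ?J)" by (simp_all add: cospan_shape_def)
  moreover have "finitely_complete C" using regular unfolding regular_def by blast
  ultimately obtain L \<pi> where L: "is_limit ?J C Fo Fa L \<pi>"
    using cospan_shape_category unfolding finitely_complete_def by blast
  then have cone: "is_cone ?J C Fo Fa L \<pi>" unfolding is_limit_def by blast
  have \<pi>: "\<pi> 0 \<in> hom C L X" "\<pi> 1 \<in> hom C L Y" "f \<cdot> \<pi> 0 = \<pi> 2" "g \<cdot> \<pi> 1 = \<pi> 2"
    using cone unfolding is_cone_def cospan_shape_def by (auto simp: Fo Fa)
  have "is_pullback C f g (\<pi> 1) (\<pi> 0)"
  proof (rule pullbackI[OF f g \<pi>(2,1)])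
    show "f \<cdot> \<pi> 0 = g \<cdot> \<pi> 1" using \<pi> by simp
    fix T a b
    assume T: "T \<in> Ob C" and a: "a \<in> hom C T Y" and b: "b \<in> hom C T X" and eq: "f \<cdot> b = g \<cdot> a"
    define \<sigma> where "\<sigma> j = (if j = 0 then b else if j = 1 then a else f \<cdot> b)" for j :: nat
    have \<sigma>: "\<sigma> 0 = b" "\<sigma> (Suc 0) = a" "\<sigma> 2 = f \<cdot> b" unfolding \<sigma>_def by simp_all
    have "is_cone ?J C Fo Fa T \<sigma>"
      unfolding is_cone_def cospan_shape_def
      using T a b eq comp_hom[OF b f] comp_ident_left[OF a] comp_ident_left[OF b]
        comp_ident_left[OF comp_hom[OF b f]]
      by (auto simp: \<sigma> Fo Fa)
    then have "\<exists>!u. u \<in> hom C T L \<and> (\<forall>j \<in> Ob ?J. \<pi> j \<cdot> u = \<sigma> j)"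
      using L unfolding is_limit_def by blast
    moreover have "(\<forall>j \<in> Ob ?J. \<pi> j \<cdot> u = \<sigma> j) \<longleftrightarrow> \<pi> 1 \<cdot> u = a \<and> \<pi> 0 \<cdot> u = b"
      if u: "u \<in> hom C T L" for u
      using comp_assoc[OF u \<pi>(1) f] \<pi>(3) unfolding cospan_shape_def by (auto simp: \<sigma>)
    ultimately show "\<exists>!u. u \<in> hom C T L \<and> \<pi> 1 \<cdot> u = a \<and> \<pi> 0 \<cdot> u = b"
      by (metis (no_types, lifting))
  qed
  then show thesis using that by blast
qed

text \<open>Stability is postulated for whole factorisations; pulling back \<open>1 \<cdot> q\<close> isolates its
  regular epimorphism part.\<close>

lemma regular_epi_pullback_stable:
  assumes q: "is_regular_epi C q" "q \<in> hom C A B" and g: "g \<in> hom C D B"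
    and pb: "is_pullback C q g q' g'"
  shows "is_regular_epi C q'"
proof -
  have stable: "\<forall>f q m g m' g' q' g''.
      regepi_mono_factorisation C f q m \<and> is_pullback C m g m' g' \<and> is_pullback C q g' q' g''
      \<longrightarrow> regepi_mono_factorisation C (m' \<cdot> q') q' m'"
    using regular unfolding regular_def by (elim conjE)
  have B: "B \<in> Ob C" using hom_Ob[OF g] by simp
  have "regepi_mono_factorisation C q q (Ident C B)"
    unfolding regepi_mono_factorisation_def
    using q ident_mono[OF B] comp_ident_left[OF q(2)] homD[OF q(2)] homD[OF ident_hom[OF B]]
    by simp
  then have "regepi_mono_factorisation C (Ident C D \<cdot> q') q' (Ident C D)"
    by (rule stable[rule_format, OF conjI[OF _ conjI[OF ident_pullback[OF g] pb]]])
  then show ?thesis unfolding regepi_mono_factorisation_def by blast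
qed

lemma image_factorisation:
  assumes f: "f \<in> hom C X Y"
  obtains M q m where "is_regular_epi C q" "is_mono C m" "q \<in> hom C X M" "m \<in> hom C M Y"
    "f = m \<cdot> q"
proof -
  have "\<forall>f \<in> Arr C. \<exists>q m. regepi_mono_factorisation C f q m"
    using regular unfolding regular_def by (elim conjE)
  then obtain q m where fac: "regepi_mono_factorisation C f q m"
    using homD[OF f] by blast
  then have q: "is_regular_epi C q" and m: "is_mono C m" and qm: "Cod C q = Dom C m"
    and fqm: "f = m \<cdot> q"
    unfolding regepi_mono_factorisation_def by blast+
  have q': "q \<in> hom C (Dom C q) (Dom C m)" using regular_epi_Arr[OF q, THEN Arr_hom] qm by simp
  have "m \<in> Arr C" using m unfolding is_mono_def by (elim conjE)
  then have m': "m \<in> hom C (Dom C m) (Cod C m)" by (rule Arr_hom)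
  have "m \<cdot> q \<in> hom C X Y" using f unfolding fqm .
  then have X: "Dom C q = X" and Y: "Cod C m = Y"
    using homD[OF comp_hom[OF q' m']] homD[of "m \<cdot> q" C X Y] by simp_all
  show thesis by (rule that[OF q m q'[unfolded X] m'[unfolded Y] fqm])
qed

text \<open>In an image factorisation \<open>g = m \<cdot> q\<close>, the monomorphism \<open>m\<close> splits, since the regular
  epimorphism \<open>g \<cdot> f\<close> lifts against it; so \<open>m\<close> is an isomorphism.\<close>

lemma regular_epi_cancel:
  assumes f: "f \<in> hom C X Y" and g: "g \<in> hom C Y Z" and gf: "is_regular_epi C (g \<cdot> f)"
  shows "is_regular_epi C g"
proof -
  obtain M q m where q: "is_regular_epi C q" and m: "is_mono C m" and q': "q \<in> hom C Y M"
    and m': "m \<in> hom C M Z" and g_eq: "g = m \<cdot> q"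
    by (rule image_factorisation[OF g])
  have M: "M \<in> Ob C" and Z: "Z \<in> Ob C" using hom_Ob[OF m'] by auto
  have "m \<cdot> (q \<cdot> f) = Ident C Z \<cdot> (g \<cdot> f)"
    using comp_assoc[OF f q' m'] comp_ident_left[OF comp_hom[OF f g]] g_eq by simp
  then obtain w where w: "w \<in> hom C Z M" "m \<cdot> w = Ident C Z"
    by (rule regular_epi_mono_diagonal
        [OF gf comp_hom[OF f g] m m' comp_hom[OF f q'] ident_hom[OF Z]])
  have "m \<cdot> (w \<cdot> m) = m \<cdot> Ident C M"
    using comp_assoc[OF m' w(1) m'] w comp_ident_left[OF m'] comp_ident_right[OF m'] by simp
  then have "w \<cdot> m = Ident C M"
    using monoD[OF m m' M comp_hom[OF m' w(1)] ident_hom[OF M]] by simp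
  then show ?thesis using iso_comp_regular_epi[OF q q' m' w(1,2)] g_eq by simp
qed

section \<open>Zero morphisms, products and kernels\<close>

lemma zero_object_Ob: "is_zero_object C Z \<Longrightarrow> Z \<in> Ob C"
  unfolding is_zero_object_def by (elim conjE)

lemma zero_object_terminal:
  assumes Z: "is_zero_object C Z" and X: "X \<in> Ob C"
  shows "\<exists>!f. f \<in> hom C X Z"
proof -
  have "\<forall>X \<in> Ob C. \<exists>!f. f \<in> hom C X Z" using Z unfolding is_zero_object_def by (elim conjE)
  then show ?thesis using X by (rule bspec)
qed

lemma zero_object_initial:
  assumes Z: "is_zero_object C Z" and X: "X \<in> Ob C"
  shows "\<exists>!f. f \<in> hom C Z X"
proof -
  have "\<forall>X \<in> Ob C. \<exists>!f. f \<in> hom C Z X" using Z unfolding is_zero_object_def by (elim conjE)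
  then show ?thesis using X by (rule bspec)
qed

lemma terminal_eq:
  assumes Z: "is_zero_object C Z" and f: "f \<in> hom C X Z" and g: "g \<in> hom C X Z"
  shows "f = g"
  using zero_object_terminal[OF Z hom_Ob[OF f, THEN conjunct1]] f g by metis

lemma initial_eq:
  assumes Z: "is_zero_object C Z" and f: "f \<in> hom C Z X" and g: "g \<in> hom C Z X"
  shows "f = g"
  using zero_object_initial[OF Z hom_Ob[OF f, THEN conjunct2]] f g by metis

lemma zero_comp_right:
  assumes f: "is_zero_morphism C f" "f \<in> hom C X Y" and g: "g \<in> hom C T X"
  shows "is_zero_morphism C (f \<cdot> g)"
proof -
  obtain Z a b where Z: "is_zero_object C Z" "a \<in> hom C X Z" "b \<in> hom C Z Y" "f = b \<cdot> a"
    using f unfolding is_zero_morphism_def hom_def by auto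
  have "f \<cdot> g = b \<cdot> (a \<cdot> g)" using comp_assoc[OF g Z(2,3)] Z(4) by simp
  then show ?thesis
    using Z comp_hom[OF g Z(2)] homD[OF comp_hom[OF g f(2)]]
    unfolding is_zero_morphism_def by blast
qed

lemma zero_comp_left:
  assumes f: "is_zero_morphism C f" "f \<in> hom C X Y" and g: "g \<in> hom C Y T"
  shows "is_zero_morphism C (g \<cdot> f)"
proof -
  obtain Z a b where Z: "is_zero_object C Z" "a \<in> hom C X Z" "b \<in> hom C Z Y" "f = b \<cdot> a"
    using f unfolding is_zero_morphism_def hom_def by auto
  have "g \<cdot> f = (g \<cdot> b) \<cdot> a" using comp_assoc[OF Z(2,3) g] Z(4) by simp
  then show ?thesis
    using Z comp_hom[OF Z(3) g] homD[OF comp_hom[OF f(2) g]]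
    unfolding is_zero_morphism_def by blast
qed

text \<open>The two morphisms may factor through different zero objects; the first factorisation is
  transported along the isomorphism between these.\<close>

lemma zero_unique:
  assumes f: "is_zero_morphism C f" "f \<in> hom C X Y" and g: "is_zero_morphism C g" "g \<in> hom C X Y"
  shows "f = g"
proof -
  obtain Z a b where Z: "is_zero_object C Z" "a \<in> hom C X Z" "b \<in> hom C Z Y" "f = b \<cdot> a"
    using f unfolding is_zero_morphism_def hom_def by auto
  obtain W a' b' where W: "is_zero_object C W" "a' \<in> hom C X W" "b' \<in> hom C W Y" "g = b' \<cdot> a'"
    using g unfolding is_zero_morphism_def hom_def by auto
  have Ob: "W \<in> Ob C" by (rule zero_object_Ob[OF W(1)])
  obtain t where t: "t \<in> hom C Z W" using zero_object_initial[OF Z(1) Ob] by blast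
  have "t \<cdot> a = a'" by (rule terminal_eq[OF W(1) comp_hom[OF Z(2) t] W(2)])
  moreover have "b' \<cdot> t = b" by (rule initial_eq[OF Z(1) comp_hom[OF t W(3)] Z(3)])
  ultimately show ?thesis using comp_assoc[OF Z(2) t W(3)] Z(4) W(4) by simp
qed

lemma zero_morphism_exists:
  assumes "X \<in> Ob C" "Y \<in> Ob C"
  obtains z where "z \<in> hom C X Y" "is_zero_morphism C z"
proof -
  obtain Z where Z: "is_zero_object C Z" using pointed unfolding pointed_def by blast
  obtain a where a: "a \<in> hom C X Z" using zero_object_terminal[OF Z assms(1)] by blast
  obtain b where b: "b \<in> hom C Z Y" using zero_object_initial[OF Z assms(2)] by blast
  have "is_zero_morphism C (b \<cdot> a)"
    using Z a b homD[OF comp_hom[OF a b]] unfolding is_zero_morphism_def by blast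
  then show thesis using that comp_hom[OF a b] by blast
qed

text \<open>Products are pullbacks over a zero object, because every square over it commutes.\<close>

lemma product_exists:
  assumes X: "X \<in> Ob C" and Y: "Y \<in> Ob C"
  obtains p\<^sub>1 p\<^sub>2 where "is_product C X Y p\<^sub>1 p\<^sub>2"
proof -
  obtain Z where Z: "is_zero_object C Z" using pointed unfolding pointed_def by blast
  obtain a where a: "a \<in> hom C X Z" using zero_object_terminal[OF Z X] by blast
  obtain b where b: "b \<in> hom C Y Z" using zero_object_terminal[OF Z Y] by blast
  obtain f' g' where pb: "is_pullback C a b f' g'" by (rule pullback_exists[OF a b])
  note pb' = pullbackD[OF pb a b]
  have [simp]: "Dom C g' = Dom C f'" using pb'(2) homD by fast
  have "\<exists>!h. h \<in> hom C T (Dom C g') \<and> g' \<cdot> h = f \<and> f' \<cdot> h = g"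
    if T: "T \<in> Ob C" and f: "f \<in> hom C T X" and g: "g \<in> hom C T Y" for T f g
  proof -
    have "a \<cdot> f = b \<cdot> g" by (rule terminal_eq[OF Z comp_hom[OF f a] comp_hom[OF g b]])
    from pb'(4)[OF g f this] show ?thesis by (auto simp: conj_commute)
  qed
  then have "is_product C X Y g' f'" using pb'(1,2) unfolding is_product_def by simp
  then show thesis using that by blast
qed

lemma product_pairing:
  assumes P: "is_product C X Y p\<^sub>1 p\<^sub>2" and f: "f \<in> hom C T X" and g: "g \<in> hom C T Y"
  obtains h where "h \<in> hom C T (Dom C p\<^sub>1)" "is_pairing C p\<^sub>1 p\<^sub>2 f g h"
  using P f g hom_Ob[OF f] homD[OF f] unfolding is_product_def is_pairing_def by blast

lemma product_jointly_mono:
  assumes P: "is_product C X Y p\<^sub>1 p\<^sub>2"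
    and u: "u \<in> hom C T (Dom C p\<^sub>1)" and v: "v \<in> hom C T (Dom C p\<^sub>1)"
    and eq: "p\<^sub>1 \<cdot> u = p\<^sub>1 \<cdot> v" "p\<^sub>2 \<cdot> u = p\<^sub>2 \<cdot> v"
  shows "u = v"
proof -
  have p: "p\<^sub>1 \<in> hom C (Dom C p\<^sub>1) X" "p\<^sub>2 \<in> hom C (Dom C p\<^sub>1) Y"
    using P unfolding is_product_def by auto
  have "\<exists>!h. h \<in> hom C T (Dom C p\<^sub>1) \<and> p\<^sub>1 \<cdot> h = p\<^sub>1 \<cdot> v \<and> p\<^sub>2 \<cdot> h = p\<^sub>2 \<cdot> v"
    using P comp_hom[OF v p(1)] comp_hom[OF v p(2)] hom_Ob[OF u] unfolding is_product_def by blast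
  then show ?thesis using u v eq by auto
qed

definition is_kernel :: "'m \<Rightarrow> 'm \<Rightarrow> bool" where
  "is_kernel f k \<longleftrightarrow>
     k \<in> hom C (Dom C k) (Dom C f) \<and> is_zero_morphism C (f \<cdot> k) \<and>
     (\<forall>T. \<forall>t \<in> hom C T (Dom C f). is_zero_morphism C (f \<cdot> t) \<longrightarrow>
        (\<exists>!u. u \<in> hom C T (Dom C k) \<and> k \<cdot> u = t))"

lemma kernelI:
  assumes "f \<in> hom C X Y" "k \<in> hom C K X" "is_zero_morphism C (f \<cdot> k)"
    and "\<And>T t. \<lbrakk>t \<in> hom C T X; is_zero_morphism C (f \<cdot> t)\<rbrakk>
      \<Longrightarrow> \<exists>!u. u \<in> hom C T K \<and> k \<cdot> u = t"
  shows "is_kernel f k"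
  using assms homD[OF assms(1)] homD[OF assms(2)] unfolding is_kernel_def by simp

lemma kernelD:
  assumes "is_kernel f k" "f \<in> hom C X Y"
  shows "k \<in> hom C (Dom C k) X" "is_zero_morphism C (f \<cdot> k)"
    "\<And>T t. \<lbrakk>t \<in> hom C T X; is_zero_morphism C (f \<cdot> t)\<rbrakk>
      \<Longrightarrow> \<exists>!u. u \<in> hom C T (Dom C k) \<and> k \<cdot> u = t"
  using assms homD[OF assms(2)] unfolding is_kernel_def by auto

lemma kernel_exists:
  assumes f: "f \<in> hom C X Y"
  obtains k where "is_kernel f k"
proof -
  obtain Z where Z: "is_zero_object C Z" using pointed unfolding pointed_def by blast
  have XY: "X \<in> Ob C" "Y \<in> Ob C" "Z \<in> Ob C"
    using hom_Ob[OF f] zero_object_Ob[OF Z] by auto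
  obtain z where z: "z \<in> hom C Z Y" "is_zero_morphism C z"
    by (rule zero_morphism_exists[OF XY(3,2)])
  obtain f' k where pb: "is_pullback C f z f' k" by (rule pullback_exists[OF f z(1)])
  note pb' = pullbackD[OF pb f z(1)]
  have "is_kernel f k"
  proof (rule kernelI[OF f pb'(2)])
    show "is_zero_morphism C (f \<cdot> k)"
      using zero_comp_right[OF z(2,1) pb'(1)] pb'(3) by simp
    fix T t assume t: "t \<in> hom C T X" and ft: "is_zero_morphism C (f \<cdot> t)"
    have T: "T \<in> Ob C" using hom_Ob[OF t] by simp
    obtain a where a: "a \<in> hom C T Z" using zero_object_terminal[OF Z T] by blast
    have "f \<cdot> t = z \<cdot> a"
      by (rule zero_unique[OF ft comp_hom[OF t f] zero_comp_right[OF z(2,1) a] comp_hom[OF a z(1)]])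
    then have ex1: "\<exists>!u. u \<in> hom C T (Dom C f') \<and> f' \<cdot> u = a \<and> k \<cdot> u = t"
      using pb'(4)[OF a t] by simp
    have "f' \<cdot> u = a" if "u \<in> hom C T (Dom C f')" for u
      by (rule terminal_eq[OF Z comp_hom[OF that pb'(1)] a])
    with ex1 show "\<exists>!u. u \<in> hom C T (Dom C f') \<and> k \<cdot> u = t" by metis
  qed
  then show thesis using that by blast
qed

text \<open>A morphism \<open>t\<close> into the domain of \<open>s\<close> satisfies \<open>d' \<cdot> s \<cdot> t = 0\<close> exactly when \<open>s \<cdot> t\<close>
  factors through the kernel of \<open>d'\<close>.\<close>

lemma kernel_comparison_pullback:
  assumes d': "d' \<in> hom C S X" and s: "s \<in> hom C R S"
    and k: "is_kernel (d' \<cdot> s) k" and k': "is_kernel d' k'"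
    and \<sigma>: "\<sigma> \<in> hom C (Dom C k) (Dom C k')" and eq: "k' \<cdot> \<sigma> = s \<cdot> k"
  shows "is_pullback C s k' \<sigma> k"
proof -
  note kk = kernelD[OF k comp_hom[OF s d']] and kk' = kernelD[OF k' d']
  show ?thesis
  proof (rule pullbackI[OF s kk'(1) \<sigma> kk(1)])
    show "s \<cdot> k = k' \<cdot> \<sigma>" using eq by simp
    fix T a b
    assume a: "a \<in> hom C T (Dom C k')" and b: "b \<in> hom C T R" and ab: "s \<cdot> b = k' \<cdot> a"
    have "(d' \<cdot> s) \<cdot> b = (d' \<cdot> k') \<cdot> a"
      using comp_assoc[OF b s d'] comp_assoc[OF a kk'(1) d'] ab by simp
    then have z: "is_zero_morphism C ((d' \<cdot> s) \<cdot> b)"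
      using zero_comp_right[OF kk'(2) comp_hom[OF kk'(1) d'] a] by simp
    have "\<sigma> \<cdot> u = a" if u: "u \<in> hom C T (Dom C k)" and kub: "k \<cdot> u = b" for u
    proof -
      have "k' \<cdot> (\<sigma> \<cdot> u) = k' \<cdot> a"
        using comp_assoc[OF u \<sigma> kk'(1)] comp_assoc[OF u kk(1) s] eq kub ab by simp
      moreover have "is_zero_morphism C (d' \<cdot> (k' \<cdot> a))"
        using zero_comp_right[OF kk'(2) comp_hom[OF kk'(1) d'] a] comp_assoc[OF a kk'(1) d']
        by simp
      ultimately show ?thesis
        using kk'(3)[OF comp_hom[OF a kk'(1)]] a comp_hom[OF u \<sigma>] by metis
    qed
    with kk(3)[OF b z]
    show "\<exists>!u. u \<in> hom C T (Dom C k) \<and> \<sigma> \<cdot> u = a \<and> k \<cdot> u = b" by metis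
  qed
qed

section \<open>Zero-classes\<close>

lemma zero_class_iff_kernel:
  assumes d: "d \<in> hom C R X" and c: "c \<in> hom C R Y" and i: "i \<in> hom C I Y"
  shows "is_zero_class C X Y d c i \<longleftrightarrow> (\<exists>j \<in> hom C I R. is_kernel d j \<and> c \<cdot> j = i)"
proof
  assume "is_zero_class C X Y d c i"
  then obtain p\<^sub>1 p\<^sub>2 z dc z1 j where
    P: "is_product C X Y p\<^sub>1 p\<^sub>2" and dc: "is_pairing C p\<^sub>1 p\<^sub>2 d c dc"
    and z: "z \<in> hom C Y X" "is_zero_morphism C z"
    and z1: "is_pairing C p\<^sub>1 p\<^sub>2 z (Ident C Y) z1"
    and pb: "is_pullback C dc z1 i j"
    unfolding is_zero_class_def by blast
  let ?P = "Dom C p\<^sub>1"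
  have p: "p\<^sub>1 \<in> hom C ?P X" "p\<^sub>2 \<in> hom C ?P Y" using P unfolding is_product_def by auto
  have dc': "dc \<in> hom C R ?P" "p\<^sub>1 \<cdot> dc = d" "p\<^sub>2 \<cdot> dc = c"
    and z1': "z1 \<in> hom C Y ?P" "p\<^sub>1 \<cdot> z1 = z" "p\<^sub>2 \<cdot> z1 = Ident C Y"
    using dc z1 homD[OF d] homD[OF z(1)] unfolding is_pairing_def by auto
  note pb' = pullbackD[OF pb dc'(1) z1'(1)]
  have I: "Dom C i = I" using homD[OF i] by simp
  have j: "j \<in> hom C I R" using pb'(2) I by simp
  have dt: "p\<^sub>1 \<cdot> (dc \<cdot> t) = d \<cdot> t" "p\<^sub>2 \<cdot> (dc \<cdot> t) = c \<cdot> t" if "t \<in> hom C T R" for T t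
    using comp_assoc[OF that dc'(1) p(1)] comp_assoc[OF that dc'(1) p(2)] dc' by auto
  have za: "p\<^sub>1 \<cdot> (z1 \<cdot> a) = z \<cdot> a" "p\<^sub>2 \<cdot> (z1 \<cdot> a) = a" if "a \<in> hom C T Y" for T a
    using comp_assoc[OF that z1'(1) p(1)] comp_assoc[OF that z1'(1) p(2)] z1'
      comp_ident_left[OF that] by auto
  have cj: "c \<cdot> j = i" using dt(2)[OF j] za(2)[OF i] pb'(3) by simp
  have "is_kernel d j"
  proof (rule kernelI[OF d j])
    show "is_zero_morphism C (d \<cdot> j)"
      using dt(1)[OF j] za(1)[OF i] pb'(3) zero_comp_right[OF z(2,1) i] by simp
    fix T t assume t: "t \<in> hom C T R" and dt0: "is_zero_morphism C (d \<cdot> t)"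
    note ct = comp_hom[OF t c]
    have "d \<cdot> t = z \<cdot> (c \<cdot> t)"
      by (rule zero_unique[OF dt0 comp_hom[OF t d] zero_comp_right[OF z(2,1) ct]
            comp_hom[OF ct z(1)]])
    then have "dc \<cdot> t = z1 \<cdot> (c \<cdot> t)"
      using product_jointly_mono[OF P comp_hom[OF t dc'(1)] comp_hom[OF ct z1'(1)]]
        dt[OF t] za[OF ct] by simp
    then have ex1: "\<exists>!u. u \<in> hom C T I \<and> i \<cdot> u = c \<cdot> t \<and> j \<cdot> u = t"
      using pb'(4)[OF ct t] I by simp
    have "i \<cdot> u = c \<cdot> t" if "u \<in> hom C T I" "j \<cdot> u = t" for u
      using comp_assoc[OF that(1) j c] cj that(2) by simp
    with ex1 show "\<exists>!u. u \<in> hom C T I \<and> j \<cdot> u = t" by metis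
  qed
  with j cj show "\<exists>j \<in> hom C I R. is_kernel d j \<and> c \<cdot> j = i" by blast
next
  assume "\<exists>j \<in> hom C I R. is_kernel d j \<and> c \<cdot> j = i"
  then obtain j where j: "j \<in> hom C I R" "is_kernel d j" and cj: "c \<cdot> j = i" by blast
  note jj = kernelD[OF j(2) d]
  have Ob: "X \<in> Ob C" "Y \<in> Ob C" using hom_Ob[OF d] hom_Ob[OF c] by auto
  obtain p\<^sub>1 p\<^sub>2 where P: "is_product C X Y p\<^sub>1 p\<^sub>2" by (rule product_exists[OF Ob])
  let ?P = "Dom C p\<^sub>1"
  have p: "p\<^sub>1 \<in> hom C ?P X" "p\<^sub>2 \<in> hom C ?P Y" using P unfolding is_product_def by auto
  obtain z where z: "z \<in> hom C Y X" "is_zero_morphism C z"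
    by (rule zero_morphism_exists[OF Ob(2,1)])
  obtain dc where dc: "dc \<in> hom C R ?P" "is_pairing C p\<^sub>1 p\<^sub>2 d c dc"
    by (rule product_pairing[OF P d c])
  obtain z1 where z1: "z1 \<in> hom C Y ?P" "is_pairing C p\<^sub>1 p\<^sub>2 z (Ident C Y) z1"
    by (rule product_pairing[OF P z(1) ident_hom[OF Ob(2)]])
  have dc': "p\<^sub>1 \<cdot> dc = d" "p\<^sub>2 \<cdot> dc = c" and z1': "p\<^sub>1 \<cdot> z1 = z" "p\<^sub>2 \<cdot> z1 = Ident C Y"
    using dc z1 unfolding is_pairing_def by auto
  have dt: "p\<^sub>1 \<cdot> (dc \<cdot> t) = d \<cdot> t" "p\<^sub>2 \<cdot> (dc \<cdot> t) = c \<cdot> t" if "t \<in> hom C T R" for T t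
    using comp_assoc[OF that dc(1) p(1)] comp_assoc[OF that dc(1) p(2)] dc' by auto
  have za: "p\<^sub>1 \<cdot> (z1 \<cdot> a) = z \<cdot> a" "p\<^sub>2 \<cdot> (z1 \<cdot> a) = a" if "a \<in> hom C T Y" for T a
    using comp_assoc[OF that z1(1) p(1)] comp_assoc[OF that z1(1) p(2)] z1'
      comp_ident_left[OF that] by auto
  have I: "Dom C j = I" using homD[OF j(1)] by simp
  have "is_pullback C dc z1 i j"
  proof (rule pullbackI[OF dc(1) z1(1) i j(1)])
    have "d \<cdot> j = z \<cdot> i"
      by (rule zero_unique[OF jj(2) comp_hom[OF j(1) d] zero_comp_right[OF z(2,1) i]
            comp_hom[OF i z(1)]])
    then show "dc \<cdot> j = z1 \<cdot> i"
      using product_jointly_mono[OF P comp_hom[OF j(1) dc(1)] comp_hom[OF i z1(1)]]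
        dt[OF j(1)] za[OF i] cj by simp
    fix T a b
    assume a: "a \<in> hom C T Y" and b: "b \<in> hom C T R" and ab: "dc \<cdot> b = z1 \<cdot> a"
    have "d \<cdot> b = z \<cdot> a" and cb: "c \<cdot> b = a" using dt[OF b] za[OF a] ab by auto
    then have db: "is_zero_morphism C (d \<cdot> b)" using zero_comp_right[OF z(2,1) a] by simp
    have "i \<cdot> u = a" if "u \<in> hom C T I" "j \<cdot> u = b" for u
      using comp_assoc[OF that(1) j(1) c] cj that(2) cb by simp
    with jj(3)[OF b db] I
    show "\<exists>!u. u \<in> hom C T I \<and> i \<cdot> u = a \<and> j \<cdot> u = b" by metis
  qed
  moreover have "is_span C X Y d c" using d c homD[OF d] unfolding is_span_def by simp
  ultimately show "is_zero_class C X Y d c i"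
    using P dc z z1 unfolding is_zero_class_def by blast
qed

text \<open>Two elements of the kernel of \<open>d\<close> agree in \<open>X\<close>, so joint monicity makes \<open>c\<close> separate them.\<close>

lemma relation_zero_class_mono:
  assumes d: "d \<in> hom C R X" and c: "c \<in> hom C R Y" and jm: "jointly_mono C d c"
    and k: "is_kernel d k"
  shows "is_mono C (c \<cdot> k)"
  unfolding is_mono_def
proof (intro conjI ballI impI)
  note kk = kernelD[OF k d]
  note ck = comp_hom[OF kk(1) c]
  show "c \<cdot> k \<in> Arr C" using ck homD by fast
  fix T u v
  assume T: "T \<in> Ob C" and "u \<in> hom C T (Dom C (c \<cdot> k))" "v \<in> hom C T (Dom C (c \<cdot> k))"
    and eq: "(c \<cdot> k) \<cdot> u = (c \<cdot> k) \<cdot> v"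
  then have u: "u \<in> hom C T (Dom C k)" and v: "v \<in> hom C T (Dom C k)" using homD[OF ck] by auto
  note ku = comp_hom[OF u kk(1)] and kv = comp_hom[OF v kk(1)]
  have "c \<cdot> (k \<cdot> u) = c \<cdot> (k \<cdot> v)"
    using comp_assoc[OF u kk(1) c] comp_assoc[OF v kk(1) c] eq by simp
  moreover have zu: "is_zero_morphism C (d \<cdot> (k \<cdot> u))"
    and zv: "is_zero_morphism C (d \<cdot> (k \<cdot> v))"
    using zero_comp_right[OF kk(2) comp_hom[OF kk(1) d] u]
      zero_comp_right[OF kk(2) comp_hom[OF kk(1) d] v]
      comp_assoc[OF u kk(1) d] comp_assoc[OF v kk(1) d] by simp_all
  then have "d \<cdot> (k \<cdot> u) = d \<cdot> (k \<cdot> v)"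
    using zero_unique[OF zu comp_hom[OF ku d] zv comp_hom[OF kv d]] by simp
  ultimately have "k \<cdot> u = k \<cdot> v"
    using jm ku kv T homD[OF d] unfolding jointly_mono_def by simp
  then show "u = v" using kk(3)[OF ku zu] u v by metis
qed

section \<open>Ideals\<close>

text \<open>The kernel pair \<open>(a, b)\<close> of \<open>f\<close> is reflexive, and an element \<open>(0, x)\<close> of it is an element
  \<open>x\<close> of the kernel of \<open>f\<close>.\<close>

lemma kernel_is_clot:
  assumes f: "f \<in> hom C X Y" and k: "is_kernel f k"
  shows "is_clot C X k"
proof -
  note kk = kernelD[OF k f]
  obtain b a where pb: "is_pullback C f f b a" by (rule pullback_exists[OF f f])
  let ?E = "Dom C b"
  note pb' = pullbackD[OF pb f f]
  have b: "b \<in> hom C ?E X" and a: "a \<in> hom C ?E X" and fab: "f \<cdot> a = f \<cdot> b" using pb' by auto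
  have E: "Dom C a = ?E" using homD[OF a] by simp
  have X: "X \<in> Ob C" using hom_Ob[OF f] by simp
  have "jointly_mono C a b"
    unfolding jointly_mono_def
  proof (intro ballI impI)
    fix T u v
    assume u: "u \<in> hom C T (Dom C a)" and v: "v \<in> hom C T (Dom C a)"
      and eq: "a \<cdot> u = a \<cdot> v \<and> b \<cdot> u = b \<cdot> v"
    have u': "u \<in> hom C T ?E" and v': "v \<in> hom C T ?E" using u v E by auto
    have "f \<cdot> (a \<cdot> u) = f \<cdot> (b \<cdot> u)"
      using comp_assoc[OF u' a f] comp_assoc[OF u' b f] fab by simp
    from pb'(4)[OF comp_hom[OF u' b] comp_hom[OF u' a] this]
    show "u = v" using u' v' eq by metis
  qed
  moreover obtain e where "e \<in> hom C X ?E" "b \<cdot> e = Ident C X" "a \<cdot> e = Ident C X"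
    using pb'(4)[OF ident_hom[OF X] ident_hom[OF X]] by blast
  ultimately have refl: "is_reflexive_relation C X a b"
    unfolding is_reflexive_relation_def is_relation_def is_span_def using a b E by auto
  have Ob: "Dom C k \<in> Ob C" using hom_Ob[OF kk(1)] by simp
  obtain z where z: "z \<in> hom C (Dom C k) X" "is_zero_morphism C z"
    by (rule zero_morphism_exists[OF Ob X])
  have fz: "f \<cdot> z = f \<cdot> k"
    by (rule zero_unique[OF zero_comp_left[OF z(2,1) f] comp_hom[OF z(1) f] kk(2)
          comp_hom[OF kk(1) f]])
  \<comment> \<open>The kernel of \<open>a\<close> is \<open>\<langle>0, k\<rangle>\<close>.\<close>
  obtain j where j: "j \<in> hom C (Dom C k) ?E" "b \<cdot> j = k" "a \<cdot> j = z"
    using pb'(4)[OF kk(1) z(1) fz] by blast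
  have "is_kernel a j"
  proof (rule kernelI[OF a j(1)])
    show "is_zero_morphism C (a \<cdot> j)" using j z by simp
    fix T t assume t: "t \<in> hom C T ?E" and at: "is_zero_morphism C (a \<cdot> t)"
    note bt = comp_hom[OF t b] and at' = comp_hom[OF t a]
    have fbt: "f \<cdot> (a \<cdot> t) = f \<cdot> (b \<cdot> t)"
      using comp_assoc[OF t a f] comp_assoc[OF t b f] fab by simp
    then have "is_zero_morphism C (f \<cdot> (b \<cdot> t))" using zero_comp_left[OF at at' f] by simp
    then have ex1: "\<exists>!u. u \<in> hom C T (Dom C k) \<and> k \<cdot> u = b \<cdot> t" by (rule kk(3)[OF bt])
    have "j \<cdot> u = t \<longleftrightarrow> k \<cdot> u = b \<cdot> t" if u: "u \<in> hom C T (Dom C k)" for u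
    proof
      assume "j \<cdot> u = t"
      then show "k \<cdot> u = b \<cdot> t" using comp_assoc[OF u j(1) b] j by auto
    next
      assume "k \<cdot> u = b \<cdot> t"
      then have bj: "b \<cdot> (j \<cdot> u) = b \<cdot> t" using comp_assoc[OF u j(1) b] j by simp
      have "a \<cdot> (j \<cdot> u) = z \<cdot> u" using comp_assoc[OF u j(1) a] j by simp
      also have "\<dots> = a \<cdot> t"
        by (rule zero_unique[OF zero_comp_right[OF z(2,1) u] comp_hom[OF u z(1)] at at'])
      finally show "j \<cdot> u = t"
        using pb'(4)[OF bt at' fbt] t comp_hom[OF u j(1)] bj by metis
    qed
    with ex1 show "\<exists>!u. u \<in> hom C T (Dom C k) \<and> j \<cdot> u = t" by metis
  qed
  then have "is_zero_class C X X a b k"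
    using zero_class_iff_kernel[OF a b kk(1)] j by blast
  with refl show ?thesis unfolding is_clot_def by blast
qed

lemma surjective_relation_zero_class_is_ideal:
  assumes i: "i \<in> hom C I Y" and r: "is_surjective_relation C X Y d c"
    and zc: "is_zero_class C X Y d c i"
  shows "is_ideal C i"
proof -
  let ?R = "Dom C d"
  have d: "d \<in> hom C ?R X" and c: "c \<in> hom C ?R Y" and c_epi: "is_regular_epi C c"
    and jm: "jointly_mono C d c"
    using r unfolding is_surjective_relation_def is_surjective_span_def is_relation_def is_span_def
    by auto
  obtain k where k: "k \<in> hom C I ?R" "is_kernel d k" "c \<cdot> k = i"
    using zc zero_class_iff_kernel[OF d c i] by blast
  have I: "I \<in> Ob C" using hom_Ob[OF i] by simp
  have "is_mono C i" using relation_zero_class_mono[OF d c jm k(2)] k(3) by simp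
  moreover have "i \<cdot> Ident C I = c \<cdot> k" using comp_ident_right[OF i] k(3) by simp
  ultimately show ?thesis
    unfolding is_ideal_def
    using k(1) kernel_is_clot[OF d k(2)] c c_epi ident_hom[OF I] ident_regular_epi[OF I] homD[OF i]
    by metis
qed

lemma ideal_is_zero_class:
  assumes i: "i \<in> hom C I Y" and ideal: "is_ideal C i"
  shows "\<exists>X \<in> Ob C. \<exists>d c e.
           is_surjective_left_split_relation C X Y d c e \<and> is_zero_class C X Y d c i"
proof -
  obtain K X k p q where im: "is_mono C i" and k: "k \<in> hom C K X" and clot: "is_clot C X k"
    and p: "p \<in> hom C X Y" "is_regular_epi C p" and q: "q \<in> hom C K I" "is_regular_epi C q"
    and iq: "i \<cdot> q = p \<cdot> k"
    using ideal homD[OF i] unfolding is_ideal_def by metis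
  obtain d c where refl: "is_reflexive_relation C X d c" and zc: "is_zero_class C X X d c k"
    using clot unfolding is_clot_def by blast
  let ?R = "Dom C d"
  obtain e where d: "d \<in> hom C ?R X" and c: "c \<in> hom C ?R X" and e: "e \<in> hom C X ?R"
    and de: "d \<cdot> e = Ident C X" and ce: "c \<cdot> e = Ident C X"
    using refl unfolding is_reflexive_relation_def is_relation_def is_span_def by auto
  obtain \<kappa> where \<kappa>: "\<kappa> \<in> hom C K ?R" "is_kernel d \<kappa>" and c\<kappa>: "c \<cdot> \<kappa> = k"
    using zc zero_class_iff_kernel[OF d c k] by blast
  have X: "X \<in> Ob C" and Y: "Y \<in> Ob C" using hom_Ob[OF p(1)] by auto
  \<comment> \<open>The image \<open>(d', c')\<close> of the span \<open>(d, p \<cdot> c)\<close>.\<close>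
  obtain p\<^sub>1 p\<^sub>2 where P: "is_product C X Y p\<^sub>1 p\<^sub>2" by (rule product_exists[OF X Y])
  have pr: "p\<^sub>1 \<in> hom C (Dom C p\<^sub>1) X" "p\<^sub>2 \<in> hom C (Dom C p\<^sub>1) Y"
    using P unfolding is_product_def by auto
  obtain h where h: "h \<in> hom C ?R (Dom C p\<^sub>1)" "is_pairing C p\<^sub>1 p\<^sub>2 d (p \<cdot> c) h"
    by (rule product_pairing[OF P d comp_hom[OF c p(1)]])
  obtain S s m where s: "is_regular_epi C s" "s \<in> hom C ?R S"
    and m: "is_mono C m" "m \<in> hom C S (Dom C p\<^sub>1)" and hms: "h = m \<cdot> s"
    using image_factorisation[OF h(1)] by metis
  define d' c' where "d' = p\<^sub>1 \<cdot> m" and "c' = p\<^sub>2 \<cdot> m"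
  have d': "d' \<in> hom C S X" and c': "c' \<in> hom C S Y"
    unfolding d'_def c'_def using comp_hom[OF m(2)] pr by auto
  have d's: "d' \<cdot> s = d" and c's: "c' \<cdot> s = p \<cdot> c"
    unfolding d'_def c'_def
    using comp_assoc[OF s(2) m(2) pr(1)] comp_assoc[OF s(2) m(2) pr(2)] hms h(2)
    unfolding is_pairing_def by auto
  have S: "Dom C d' = S" using homD[OF d'] by simp
  have jm: "jointly_mono C d' c'"
    unfolding jointly_mono_def S
  proof (intro ballI impI)
    fix T u v
    assume T: "T \<in> Ob C" and u: "u \<in> hom C T S" and v: "v \<in> hom C T S"
      and eq: "d' \<cdot> u = d' \<cdot> v \<and> c' \<cdot> u = c' \<cdot> v"
    have "m \<cdot> u = m \<cdot> v"
      using product_jointly_mono[OF P comp_hom[OF u m(2)] comp_hom[OF v m(2)]] eq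
        comp_assoc[OF u m(2)] comp_assoc[OF v m(2)] pr
      unfolding d'_def c'_def by simp
    then show "u = v" using monoD[OF m T u v] by simp
  qed
  have se: "s \<cdot> e \<in> hom C X S" by (rule comp_hom[OF e s(2)])
  have split: "d' \<cdot> (s \<cdot> e) = Ident C X" using comp_assoc[OF e s(2) d'] d's de by simp
  have "c' \<cdot> (s \<cdot> e) = p"
    using comp_assoc[OF e s(2) c'] comp_assoc[OF e c p(1)] c's ce comp_ident_right[OF p(1)]
    by simp
  then have "is_regular_epi C c'" using regular_epi_cancel[OF se c'] p(2) by simp
  then have rel: "is_surjective_left_split_relation C X Y d' c' (s \<cdot> e)"
    unfolding is_surjective_left_split_relation_def is_left_split_relation_def
      is_left_split_span_def is_span_def S
    using d' c' se split jm by simp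
  \<comment> \<open>The comparison of kernels is a regular epimorphism.\<close>
  obtain \<kappa>' where \<kappa>': "is_kernel d' \<kappa>'" by (rule kernel_exists[OF d'])
  let ?K' = "Dom C \<kappa>'"
  note kk' = kernelD[OF \<kappa>' d'] and kk = kernelD[OF \<kappa>(2) d]
  have K: "Dom C \<kappa> = K" using homD[OF \<kappa>(1)] by simp
  have "is_zero_morphism C (d' \<cdot> (s \<cdot> \<kappa>))" using comp_assoc[OF \<kappa>(1) s(2) d'] d's kk(2) by simp
  then obtain \<sigma> where \<sigma>: "\<sigma> \<in> hom C K ?K'" "\<kappa>' \<cdot> \<sigma> = s \<cdot> \<kappa>"
    using kk'(3)[OF comp_hom[OF \<kappa>(1) s(2)]] by blast
  have "is_pullback C s \<kappa>' \<sigma> \<kappa>"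
    using kernel_comparison_pullback[OF d' s(2) _ \<kappa>' _ \<sigma>(2)] \<kappa>(2) \<sigma>(1) d's K by simp
  then have \<sigma>_epi: "is_regular_epi C \<sigma>" by (rule regular_epi_pullback_stable[OF s kk'(1)])
  \<comment> \<open>The two factorisations of \<open>p \<cdot> k\<close> agree up to isomorphism.\<close>
  define i' where "i' = c' \<cdot> \<kappa>'"
  have i': "i' \<in> hom C ?K' Y" unfolding i'_def by (rule comp_hom[OF kk'(1) c'])
  have i'm: "is_mono C i'" unfolding i'_def by (rule relation_zero_class_mono[OF d' c' jm \<kappa>'])
  have "i' \<cdot> \<sigma> = (c' \<cdot> s) \<cdot> \<kappa>"
    unfolding i'_def using comp_assoc[OF \<sigma>(1) kk'(1) c'] comp_assoc[OF \<kappa>(1) s(2) c'] \<sigma>(2) by simp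
  also have "\<dots> = i \<cdot> q" using c's comp_assoc[OF \<kappa>(1) c p(1)] c\<kappa> iq by simp
  finally have fac: "i' \<cdot> \<sigma> = i \<cdot> q" .
  obtain u where u: "u \<in> hom C I ?K'" "u \<cdot> q = \<sigma>" "i' \<cdot> u = i"
    by (rule regular_epi_mono_diagonal[OF q(2,1) i'm i' \<sigma>(1) i fac])
  obtain v where v: "v \<in> hom C ?K' I" "v \<cdot> \<sigma> = q" "i \<cdot> v = i'"
    by (rule regular_epi_mono_diagonal[OF \<sigma>_epi \<sigma>(1) im i q(1) i' fac[symmetric]])
  have K'_Ob: "?K' \<in> Ob C" using hom_Ob[OF i'] by simp
  have "i' \<cdot> (u \<cdot> v) = i' \<cdot> Ident C ?K'"
    using comp_assoc[OF v(1) u(1) i'] u v comp_ident_right[OF i'] by simp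
  then have uv: "u \<cdot> v = Ident C ?K'"
    using monoD[OF i'm i' K'_Ob comp_hom[OF v(1) u(1)] ident_hom[OF K'_Ob]] by simp
  \<comment> \<open>Transporting \<open>\<kappa>'\<close> along this isomorphism gives a kernel of \<open>d'\<close> with domain \<open>I\<close>.\<close>
  note ku = comp_hom[OF u(1) kk'(1)]
  have cku: "c' \<cdot> (\<kappa>' \<cdot> u) = i" using comp_assoc[OF u(1) kk'(1) c'] u(3) i'_def by simp
  have um: "is_mono C (\<kappa>' \<cdot> u)" using mono_comp_factor[OF _ ku c'] cku im by simp
  have "is_kernel d' (\<kappa>' \<cdot> u)"
  proof (rule kernelI[OF d' ku])
    show "is_zero_morphism C (d' \<cdot> (\<kappa>' \<cdot> u))"
      using zero_comp_right[OF kk'(2) comp_hom[OF kk'(1) d'] u(1)] comp_assoc[OF u(1) kk'(1) d']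
      by simp
    fix T t assume t: "t \<in> hom C T S" "is_zero_morphism C (d' \<cdot> t)"
    have T: "T \<in> Ob C" using hom_Ob[OF t(1)] by simp
    obtain w where w: "w \<in> hom C T ?K'" "\<kappa>' \<cdot> w = t" using kk'(3)[OF t] by blast
    note vw = comp_hom[OF w(1) v(1)]
    have "(\<kappa>' \<cdot> u) \<cdot> (v \<cdot> w) = \<kappa>' \<cdot> ((u \<cdot> v) \<cdot> w)"
      using comp_assoc[OF vw u(1) kk'(1)] comp_assoc[OF w(1) v(1) u(1)] by simp
    also have "\<dots> = t" using uv comp_ident_left[OF w(1)] w(2) by simp
    finally have "(\<kappa>' \<cdot> u) \<cdot> (v \<cdot> w) = t" .
    then show "\<exists>!x. x \<in> hom C T I \<and> (\<kappa>' \<cdot> u) \<cdot> x = t"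
      using vw monoD[OF um ku T] by (intro ex1I[of _ "v \<cdot> w"]) auto
  qed
  then have "is_zero_class C X Y d' c' i"
    using zero_class_iff_kernel[OF d' c' i] ku cku by blast
  with rel X show ?thesis by blast
qed

end

lemma surjective_left_split_relation_is_surjective_relation:
  "is_surjective_left_split_relation C X Y d c e \<Longrightarrow> is_surjective_relation C X Y d c"
  unfolding is_surjective_left_split_relation_def is_left_split_relation_def
    is_left_split_span_def is_surjective_relation_def is_surjective_span_def is_relation_def
  by blast

theorem theorem3p4:
  fixes C :: "('o, 'm) category_data"
    and I Y :: 'o
    and i :: 'm
  assumes "category C"
    and "pointed C"
    and "regular C"
    and "i \<in> hom C I Y"
  shows "(is_ideal C i \<longleftrightarrow>
           (\<exists>X \<in> Ob C. \<exists>d c e.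
              is_surjective_left_split_relation C X Y d c e \<and> is_zero_class C X Y d c i)) \<and>
         ((\<exists>X \<in> Ob C. \<exists>d c e.
              is_surjective_left_split_relation C X Y d c e \<and> is_zero_class C X Y d c i) \<longleftrightarrow>
           (\<exists>X \<in> Ob C. \<exists>d c.
              is_surjective_relation C X Y d c \<and> is_zero_class C X Y d c i))"
proof -
  interpret pointed_regular_category C
    using assms(1-3) by (simp add: pointed_regular_category_def pointed_regular_category_axioms_def)
  let ?ii = "\<exists>X \<in> Ob C. \<exists>d c e.
    is_surjective_left_split_relation C X Y d c e \<and> is_zero_class C X Y d c i"
  let ?iii = "\<exists>X \<in> Ob C. \<exists>d c. is_surjective_relation C X Y d c \<and> is_zero_class C X Y d c i"
  have "is_ideal C i \<Longrightarrow> ?ii" by (rule ideal_is_zero_class[OF assms(4)])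
  moreover have "?ii \<Longrightarrow> ?iii"
    by (elim bexE exE conjE)
      (intro bexI exI conjI surjective_left_split_relation_is_surjective_relation)
  moreover have "?iii \<Longrightarrow> is_ideal C i"
    by (elim bexE exE conjE) (rule surjective_relation_zero_class_is_ideal[OF assms(4)])
  ultimately show ?thesis by argo
qed

end
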